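(* Let $N$ be a finite set. For any semi-graphoid independence relation $\mathcal{I}\subset\mathcal{T}(N)$ we have $$\mathrm{com}_{strong}(\mathcal{I})\le\mathrm{com}_{sem}(\mathcal{I}).$$ If $\mathcal{I}$ contains only trivially stable independence statements (that is, every triplet that is stable in $\mathcal{I}$ is trivially stable), then $\mathrm{com}_{strong}(\mathcal{I})=\mathrm{com}_{sem}(\mathcal{I})$.
   Context: $N=\{1,\dots,n\}$ with $n\ge 1$. $\mathcal{T}(N)$ is the set of ordered triplets $\langle A,B|C\rangle$ of pairwise disjoint subsets of $N$ with $A,B$ non-empty. $AB$ denotes $A\cup B$; $\subset$ allows equality. $\mathcal{I}\langle A,B|C\rangle$ means $\langle A,B|C\rangle\in\mathcal{I}$. Axioms are asserted for all subsets $X,Y,Z,W$ of $N$ for which the triplets occurring are in $\mathcal{T}(N)$. A relation $\mathcal{I}\subset\mathcal{T}(N)$ is a semi-graphoid independence relation if it satisfies: A1: $\mathcal{I}\langle X,Y|Z\rangle\to\mathcal{I}\langle Y,X|Z\rangle$; A2: $\mathcal{I}\langle X,YW|Z\rangle\to\mathcal{I}\langle X,Y|Z\rangle\wedge\mathcal{I}\langle X,W|Z\rangle$; A3: $\mathcal{I}\langle X,YW|Z\rangle\to\mathcal{I}\langle X,Y|WZ\rangle$; A4: $\mathcal{I}\langle X,Y|Z\rangle\wedge\mathcal{I}\langle X,W|YZ\rangle\to\mathcal{I}\langle X,YW|Z\rangle$. It is a stable semi-graphoid independence relation if in addition it satisfies the strong union axiom $\mathcal{I}\langle X,Y|Z\rangle\to\mathcal{I}\langle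 X,Y|ZW\rangle$. For $\mathcal{D}\subset\mathcal{T}(N)$, $\mathrm{sem}(\mathcal{D})$ is the intersection of all semi-graphoid independence relations in $\mathcal{T}(N)$ containing $\mathcal{D}$, and $\mathrm{stab}(\mathcal{D})$ is the intersection of all stable semi-graphoid independence relations in $\mathcal{T}(N)$ containing $\mathcal{D}$. A triplet $\langle X,Y|Z\rangle\in\mathcal{I}$ is stable in $\mathcal{I}$ if $\langle X,Y|Z'\rangle\in\mathcal{I}$ for all $Z'$ with $Z\subset Z'\subset N\setminus XY$; it is trivially stable if $XYZ=N$. Complexities of a semi-graphoid independence relation $\mathcal{I}$: $$\mathrm{com}_{sem}(\mathcal{I})=\min\{\mathrm{card}(\mathcal{D})\mid\mathcal{D}\subset\mathcal{T}(N),\ \mathrm{sem}(\mathcal{D})=\mathcal{I}\},$$ $$\mathrm{com}_{strong}(\mathcal{I})=\min\{\mathrm{card}(\mathcal{C})+\mathrm{card}(\mathcal{D})\mid\mathcal{C},\mathcal{D}\subset\mathcal{T}(N),\ \mathrm{sem}(\mathcal{C})\cup\mathrm{stab}(\mathcal{D})=\mathcal{I}\}.$$ *)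

theory Defs
  imports Main
begin

text \<open>A triple \<open>(A, B, C)\<close> encodes the triplet \<open>\<langle>A,B|C\<rangle>\<close>.\<close>

type_synonym 'a triplet = "'a set \<times> 'a set \<times> 'a set"

definition triplets :: "'a set \<Rightarrow> 'a triplet set" where
  "triplets N = {(A, B, C). A \<subseteq> N \<and> B \<subseteq> N \<and> C \<subseteq> N \<and> A \<noteq> {} \<and> B \<noteq> {} \<and>
     A \<inter> B = {} \<and> A \<inter> C = {} \<and> B \<inter> C = {}}"

text \<open>Each axiom is guarded by membership of all occurring triplets in \<open>triplets N\<close>. The sets
  \<open>X\<close>, \<open>Y\<close>, \<open>Z\<close>, \<open>W\<close> are thereby subsets of \<open>N\<close>. They are not otherwise required to be pairwise
  disjoint or non-empty.\<close>

definition symmetry_axiom :: "'a set \<Rightarrow> 'a triplet set \<Rightarrow> bool" where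
  "symmetry_axiom N I \<longleftrightarrow> (\<forall>X Y Z.
     (X, Y, Z) \<in> triplets N \<and> (Y, X, Z) \<in> triplets N \<longrightarrow>
     (X, Y, Z) \<in> I \<longrightarrow> (Y, X, Z) \<in> I)"

definition decomposition_axiom :: "'a set \<Rightarrow> 'a triplet set \<Rightarrow> bool" where
  "decomposition_axiom N I \<longleftrightarrow> (\<forall>X Y Z W.
     (X, Y \<union> W, Z) \<in> triplets N \<and> (X, Y, Z) \<in> triplets N \<and> (X, W, Z) \<in> triplets N \<longrightarrow>
     (X, Y \<union> W, Z) \<in> I \<longrightarrow> (X, Y, Z) \<in> I \<and> (X, W, Z) \<in> I)"

definition weak_union_axiom :: "'a set \<Rightarrow> 'a triplet set \<Rightarrow> bool" where
  "weak_union_axiom N I \<longleftrightarrow> (\<forall>X Y Z W.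
     (X, Y \<union> W, Z) \<in> triplets N \<and> (X, Y, W \<union> Z) \<in> triplets N \<longrightarrow>
     (X, Y \<union> W, Z) \<in> I \<longrightarrow> (X, Y, W \<union> Z) \<in> I)"

definition contraction_axiom :: "'a set \<Rightarrow> 'a triplet set \<Rightarrow> bool" where
  "contraction_axiom N I \<longleftrightarrow> (\<forall>X Y Z W.
     (X, Y, Z) \<in> triplets N \<and> (X, W, Y \<union> Z) \<in> triplets N \<and> (X, Y \<union> W, Z) \<in> triplets N \<longrightarrow>
     (X, Y, Z) \<in> I \<and> (X, W, Y \<union> Z) \<in> I \<longrightarrow> (X, Y \<union> W, Z) \<in> I)"

definition strong_union_axiom :: "'a set \<Rightarrow> 'a triplet set \<Rightarrow> bool" where
  "strong_union_axiom N I \<longleftrightarrow> (\<forall>X Y Z W.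
     (X, Y, Z) \<in> triplets N \<and> (X, Y, Z \<union> W) \<in> triplets N \<longrightarrow>
     (X, Y, Z) \<in> I \<longrightarrow> (X, Y, Z \<union> W) \<in> I)"

definition semigraphoid :: "'a set \<Rightarrow> 'a triplet set \<Rightarrow> bool" where
  "semigraphoid N I \<longleftrightarrow> I \<subseteq> triplets N \<and> symmetry_axiom N I \<and> decomposition_axiom N I \<and>
     weak_union_axiom N I \<and> contraction_axiom N I"

definition stable_semigraphoid :: "'a set \<Rightarrow> 'a triplet set \<Rightarrow> bool" where
  "stable_semigraphoid N I \<longleftrightarrow> semigraphoid N I \<and> strong_union_axiom N I"

definition sem :: "'a set \<Rightarrow> 'a triplet set \<Rightarrow> 'a triplet set" where
  "sem N D = \<Inter>{J. semigraphoid N J \<and> D \<subseteq> J}"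

definition stab :: "'a set \<Rightarrow> 'a triplet set \<Rightarrow> 'a triplet set" where
  "stab N D = \<Inter>{J. stable_semigraphoid N J \<and> D \<subseteq> J}"

definition stable_in :: "'a set \<Rightarrow> 'a triplet set \<Rightarrow> 'a triplet \<Rightarrow> bool" where
  "stable_in N I = (\<lambda>(X, Y, Z). (X, Y, Z) \<in> I \<and>
     (\<forall>Z'. Z \<subseteq> Z' \<and> Z' \<subseteq> N - (X \<union> Y) \<longrightarrow> (X, Y, Z') \<in> I))"

definition trivially_stable :: "'a set \<Rightarrow> 'a triplet \<Rightarrow> bool" where
  "trivially_stable N = (\<lambda>(X, Y, Z). X \<union> Y \<union> Z = N)"

text \<open>For finite \<open>N\<close> and a semi-graphoid relation \<open>I\<close>, both minima below range over finite non-empty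
  sets of natural numbers: \<open>triplets N\<close> is finite, \<open>D = I\<close> is admissible for \<open>com_sem\<close>, and
  \<open>C = I\<close>, \<open>D = {}\<close> are admissible for \<open>com_strong\<close>.\<close>

definition com_sem :: "'a set \<Rightarrow> 'a triplet set \<Rightarrow> nat" where
  "com_sem N I = Min {card D | D. D \<subseteq> triplets N \<and> sem N D = I}"

definition com_strong :: "'a set \<Rightarrow> 'a triplet set \<Rightarrow> nat" where
  "com_strong N I = Min {card C + card D | C D.
     C \<subseteq> triplets N \<and> D \<subseteq> triplets N \<and> sem N C \<union> stab N D = I}"

end

theory Submission imports Defs begin

text \<open>
  The empty relation is a stable semi-graphoid relation, so \<open>stab({}) = {}\<close> and any generating set
  for \<open>sem\<close> can be used with no stable generators; this gives the inequality. Conversely, let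
  \<open>sem(C) \<union> stab(D) = I\<close>. Every element of \<open>stab(D)\<close> is stable in \<open>I\<close>. If all of these are trivially
  stable, then so are the elements of \<open>sem(D) \<subseteq> stab(D)\<close>, which therefore satisfies strong union;
  so \<open>stab(D) = sem(D)\<close> and \<open>sem(C \<union> D) = I\<close>.
\<close>

lemma finite_triplets: "finite N \<Longrightarrow> finite (triplets N)"
  by (rule finite_subset[of _ "Pow N \<times> Pow N \<times> Pow N"]) (auto simp: triplets_def)

text \<open>Each axiom is a universally quantified Horn implication, so it passes to intersections.
  Non-emptiness of \<open>F\<close> matters for the bound by \<open>triplets N\<close>, since
  \<open>\<Inter>{}\<close> is the universe.\<close>

lemma semigraphoid_Inter:
  assumes "F \<noteq> {}" and "\<And>J. J \<in> F \<Longrightarrow> semigraphoid N J"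
  shows "semigraphoid N (\<Inter>F)"
  unfolding semigraphoid_def
proof (intro conjI)
  show "\<Inter>F \<subseteq> triplets N"
    using assms unfolding semigraphoid_def by blast
  show "symmetry_axiom N (\<Inter>F)"
    using assms(2) unfolding semigraphoid_def symmetry_axiom_def by (simp only: Inter_iff) metis
  show "decomposition_axiom N (\<Inter>F)"
    using assms(2) unfolding semigraphoid_def decomposition_axiom_def by (simp only: Inter_iff) metis
  show "weak_union_axiom N (\<Inter>F)"
    using assms(2) unfolding semigraphoid_def weak_union_axiom_def by (simp only: Inter_iff) metis
  show "contraction_axiom N (\<Inter>F)"
    using assms(2) unfolding semigraphoid_def contraction_axiom_def by (simp only: Inter_iff) metis
qed

lemma stable_semigraphoid_Inter:
  assumes "F \<noteq> {}" and "\<And>J. J \<in> F \<Longrightarrow> stable_semigraphoid N J"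
  shows "stable_semigraphoid N (\<Inter>F)"
proof -
  have "strong_union_axiom N (\<Inter>F)"
    using assms(2) unfolding stable_semigraphoid_def strong_union_axiom_def
    by (simp only: Inter_iff) metis
  then show ?thesis
    using assms semigraphoid_Inter unfolding stable_semigraphoid_def by blast
qed

text \<open>The guards of every axiom already contain its conclusion. This largest relation keeps
  the families intersected in \<open>sem\<close> and \<open>stab\<close> non-empty.\<close>

lemma stable_semigraphoid_triplets: "stable_semigraphoid N (triplets N)"
  unfolding stable_semigraphoid_def semigraphoid_def symmetry_axiom_def decomposition_axiom_def
    weak_union_axiom_def contraction_axiom_def strong_union_axiom_def
  by simp

lemma stable_semigraphoid_empty: "stable_semigraphoid N {}"
  unfolding stable_semigraphoid_def semigraphoid_def symmetry_axiom_def decomposition_axiom_def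
    weak_union_axiom_def contraction_axiom_def strong_union_axiom_def
  by simp

lemma semigraphoid_sem:
  assumes "D \<subseteq> triplets N"
  shows "semigraphoid N (sem N D)"
  unfolding sem_def using assms stable_semigraphoid_triplets[of N]
  by (intro semigraphoid_Inter) (auto simp: stable_semigraphoid_def)

lemma stable_semigraphoid_stab:
  assumes "D \<subseteq> triplets N"
  shows "stable_semigraphoid N (stab N D)"
  unfolding stab_def using assms stable_semigraphoid_triplets[of N]
  by (intro stable_semigraphoid_Inter) auto

lemma sem_superset: "D \<subseteq> sem N D"
  unfolding sem_def by blast

lemma stab_superset: "D \<subseteq> stab N D"
  unfolding stab_def by blast

lemma sem_least: "semigraphoid N J \<Longrightarrow> D \<subseteq> J \<Longrightarrow> sem N D \<subseteq> J"
  unfolding sem_def by blast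

lemma stab_least: "stable_semigraphoid N J \<Longrightarrow> D \<subseteq> J \<Longrightarrow> stab N D \<subseteq> J"
  unfolding stab_def by blast

lemma sem_mono: "D \<subseteq> E \<Longrightarrow> sem N D \<subseteq> sem N E"
  unfolding sem_def by blast

lemma sem_eq_self: "semigraphoid N I \<Longrightarrow> sem N I = I"
  by (simp add: sem_least sem_superset subset_antisym)

lemma stab_empty: "stab N {} = {}"
  using stab_least[OF stable_semigraphoid_empty] by blast

lemma stable_semigraphoid_imp_stable_in:
  assumes J: "stable_semigraphoid N J" and "J \<subseteq> I" and t: "t \<in> J"
  shows "stable_in N I t"
proof -
  obtain X Y Z where eq: "t = (X, Y, Z)" by (cases t)
  have "(X, Y, Z) \<in> triplets N"
    using J t eq unfolding stable_semigraphoid_def semigraphoid_def by blast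
  have "(X, Y, Z') \<in> J" if "Z \<subseteq> Z'" "Z' \<subseteq> N - (X \<union> Y)" for Z'
  proof -
    \<comment> \<open>Strong union is applied with \<open>W = Z'\<close>; as
      \<open>Z \<subseteq> Z'\<close>, the enlarged condition \<open>Z \<union> Z'\<close> is
      \<open>Z'\<close> itself.\<close>
    have "(X, Y, Z \<union> Z') \<in> triplets N"
      using \<open>(X, Y, Z) \<in> triplets N\<close> that unfolding triplets_def by auto
    then have "(X, Y, Z \<union> Z') \<in> J"
      using J t eq \<open>(X, Y, Z) \<in> triplets N\<close>
      unfolding stable_semigraphoid_def strong_union_axiom_def by blast
    then show ?thesis using that(1) by (simp add: Un_absorb1)
  qed
  then show ?thesis
    using t eq \<open>J \<subseteq> I\<close> unfolding stable_in_def by auto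
qed

text \<open>A condition that already fills \<open>N - (X \<union> Y)\<close> cannot grow, so strong
  union only returns the triplet it started from.\<close>

lemma strong_union_axiom_trivially_stable:
  assumes "\<And>t. t \<in> J \<Longrightarrow> trivially_stable N t"
  shows "strong_union_axiom N J"
  unfolding strong_union_axiom_def
proof (intro allI impI)
  fix X Y Z W
  assume "(X, Y, Z) \<in> triplets N \<and> (X, Y, Z \<union> W) \<in> triplets N" and XYZ: "(X, Y, Z) \<in> J"
  then have "W \<subseteq> N" "X \<inter> W = {}" "Y \<inter> W = {}"
    by (auto simp: triplets_def)
  moreover have "N = X \<union> Y \<union> Z"
    using assms[OF XYZ] by (simp add: trivially_stable_def)
  ultimately have "Z \<union> W = Z"
    by auto
  with XYZ show "(X, Y, Z \<union> W) \<in> J" by simp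
qed

text \<open>Trivial stability passes down from \<open>stab N D\<close> to \<open>sem N D\<close>,
  which is thus itself stable and one of the relations intersected in
  \<open>stab N D\<close>.\<close>

lemma stab_subset_sem:
  assumes "D \<subseteq> triplets N" and "\<And>t. t \<in> stab N D \<Longrightarrow> trivially_stable N t"
  shows "stab N D \<subseteq> sem N D"
proof -
  have "sem N D \<subseteq> stab N D"
    using stable_semigraphoid_stab[OF assms(1)] stab_superset
    by (intro sem_least) (auto simp: stable_semigraphoid_def)
  then have "strong_union_axiom N (sem N D)"
    using assms(2) by (intro strong_union_axiom_trivially_stable) auto
  then have "stable_semigraphoid N (sem N D)"
    using semigraphoid_sem[OF assms(1)] by (simp add: stable_semigraphoid_def)
  then show ?thesis
    by (rule stab_least) (rule sem_superset)
qed

lemma sem_Un_eq: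
  assumes I: "semigraphoid N I" and trivial: "\<And>t. stable_in N I t \<Longrightarrow> trivially_stable N t"
    and D: "D \<subseteq> triplets N" and eq: "sem N C \<union> stab N D = I"
  shows "sem N (C \<union> D) = I"
proof
  show "sem N (C \<union> D) \<subseteq> I"
    \<comment> \<open>A union of two semi-graphoids need not be one; here it is, because it equals
      \<open>I\<close>, so \<open>I\<close> absorbs everything generated by
      \<open>C \<union> D\<close>.\<close>
    using eq sem_superset[of C N] stab_superset[of D N] by (intro sem_least[OF I]) blast
  have "stab N D \<subseteq> sem N D"
  proof (rule stab_subset_sem[OF D])
    fix t assume "t \<in> stab N D"
    then show "trivially_stable N t"
      using eq by (intro trivial stable_semigraphoid_imp_stable_in[OF stable_semigraphoid_stab[OF D]]) auto
  qed
  then show "I \<subseteq> sem N (C \<union> D)"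
    using eq sem_mono[of C "C \<union> D" N] sem_mono[of D "C \<union> D" N] by blast
qed

text \<open>\<open>Min\<close> is meaningful only on finite non-empty sets. Finiteness holds because
  the candidates are cardinalities of subsets of the finite set \<open>triplets N\<close>.\<close>

lemma com_sem_le:
  assumes "finite N" and "D \<subseteq> triplets N" and "sem N D = I"
  shows "com_sem N I \<le> card D"
proof -
  have "finite {card D | D. D \<subseteq> triplets N \<and> sem N D = I}"
    by (rule finite_subset[of _ "card ` Pow (triplets N)"]) (auto simp: finite_triplets assms)
  then show ?thesis
    unfolding com_sem_def using assms by (intro Min_le) auto
qed

lemma com_sem_witness:
  assumes "finite N" and "semigraphoid N I"
  obtains D where "D \<subseteq> triplets N" "sem N D = I" "com_sem N I = card D"
proof -
  let ?S = "{card D | D. D \<subseteq> triplets N \<and> sem N D = I}"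
  have "finite ?S"
    by (rule finite_subset[of _ "card ` Pow (triplets N)"]) (auto simp: finite_triplets assms)
  \<comment> \<open>The relation \<open>I\<close> generates itself, so \<open>card I\<close> is a
    candidate.\<close>
  moreover have "?S \<noteq> {}"
    using assms(2) sem_eq_self[OF assms(2)] unfolding semigraphoid_def by blast
  ultimately have "com_sem N I \<in> ?S"
    unfolding com_sem_def by (rule Min_in)
  then show thesis using that by blast
qed

lemma finite_com_strong_set:
  assumes "finite N"
  shows "finite {card C + card D | C D.
    C \<subseteq> triplets N \<and> D \<subseteq> triplets N \<and> sem N C \<union> stab N D = I}"
  by (rule finite_subset[of _ "(\<lambda>(C, D). card C + card D) ` (Pow (triplets N) \<times> Pow (triplets N))"])
    (auto simp: finite_triplets assms)

lemma com_strong_le: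
  assumes "finite N" and "C \<subseteq> triplets N" and "D \<subseteq> triplets N" and "sem N C \<union> stab N D = I"
  shows "com_strong N I \<le> card C + card D"
  unfolding com_strong_def using assms
  by (intro Min_le[OF finite_com_strong_set]) auto

lemma com_strong_witness:
  assumes "finite N" and "semigraphoid N I"
  obtains C D where "C \<subseteq> triplets N" "D \<subseteq> triplets N" "sem N C \<union> stab N D = I"
    "com_strong N I = card C + card D"
proof -
  let ?S = "{card C + card D | C D.
    C \<subseteq> triplets N \<and> D \<subseteq> triplets N \<and> sem N C \<union> stab N D = I}"
  \<comment> \<open>The pair \<open>C = I\<close>, \<open>D = {}\<close> shows that some
    decomposition exists.\<close>
  have "I \<subseteq> triplets N \<and> {} \<subseteq> triplets N \<and> sem N I \<union> stab N {} = I"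
    using assms(2) by (simp add: sem_eq_self stab_empty semigraphoid_def)
  then have "?S \<noteq> {}" by blast
  with finite_com_strong_set[OF assms(1)] have "com_strong N I \<in> ?S"
    unfolding com_strong_def by (rule Min_in)
  then show thesis using that by blast
qed

theorem lemma6p3:
  fixes N :: "'a set" and I :: "'a triplet set"
  assumes "finite N" and "semigraphoid N I"
  shows "com_strong N I \<le> com_sem N I \<and>
    ((\<forall>t. stable_in N I t \<longrightarrow> trivially_stable N t) \<longrightarrow> com_strong N I = com_sem N I)"
proof (intro conjI impI)
  obtain D where "D \<subseteq> triplets N" "sem N D = I" "com_sem N I = card D"
    using com_sem_witness[OF assms] .
  then show le: "com_strong N I \<le> com_sem N I"
    using com_strong_le[OF assms(1), of D "{}" I] by (simp add: stab_empty)
  assume trivial: "\<forall>t. stable_in N I t \<longrightarrow> trivially_stable N t"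
  obtain C D where CD: "C \<subseteq> triplets N" "D \<subseteq> triplets N" "sem N C \<union> stab N D = I"
    "com_strong N I = card C + card D"
    using com_strong_witness[OF assms] .
  have "sem N (C \<union> D) = I"
    by (rule sem_Un_eq[OF assms(2) _ CD(2,3)]) (simp add: trivial)
  then have "com_sem N I \<le> card (C \<union> D)"
    using CD(1,2) by (intro com_sem_le[OF assms(1)]) auto
  \<comment> \<open>\<open>C\<close> and \<open>D\<close> may overlap, but subadditivity of
    \<open>card\<close> bounds the union in the direction required.\<close>
  also have "\<dots> \<le> com_strong N I"
    using CD(4) card_Un_le[of C D] by simp
  finally show "com_strong N I = com_sem N I"
    using le by simp
qed

end
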